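(* Let $b,d\in\mathbb N$, $k,\ell\in\mathbb N_+$ with $b+\ell\ge3$ and $k\ge d+3$; set $n=b(k+1)+\ell k+d$. Choose $t\in\mathbb N$ with $d+1<t\le k-1$ and set $a=b+(b+\ell)(k-t)+t-1$. Then $g=((k+1)^{[b]},k^{[\ell]},1^{[d]})\in\mathcal J(\mathcal L_n)$, $m=(a,t^{[b+\ell-1]},d+1)\in\mathcal M(\mathcal L_n)$ is of type IV with $a\ge t+2$, and $g\swarrow m$ holds but $g\nearrow m$ does not hold.
   Context: $\mathbb N=\{0,1,2,\dots\}$, $\mathbb N_+=\mathbb N\setminus\{0\}$. A partition of $n\in\mathbb N$ is a tuple $(a_1,\dots,a_n)$ of natural numbers with $a_1\ge\dots\ge a_n\ge 0$ and $\sum a_i=n$; trailing zeros may be omitted or added. $x^{[s]}$ denotes $s$ consecutive entries equal to $x$ (no entry if $s=0$). $\mathcal L_n$ is the finite lattice of all partitions of $n$ under the dominance order: $a\le b$ iff $\sum_{i=1}^j a_i\le\sum_{i=1}^j b_i$ for all $1\le j\le n$. $\mathcal J(\mathcal L_n)$ is the set of (completely) join-irreducible elements (not the least element, and $x=y\vee z$ implies $x=y$ or $x=z$); $\mathcal M(\mathcal L_n)$ is the set of (completely) meet-irreducible elements (not the greatest element, and $x=y\wedge z$ implies $x=y$ or $x=z$). Arrow relations of the standard context $(\mathcal J(\mathcal L_n),\mathcal M(\mathcal L_n),\le)$: for $g\in\mathcal J(\mathcal L_n)$ and $m\in\mathcal M(\mathcal L_n)$ put $g'=\{y\in\mathcal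 M(\mathcal L_n): g\le y\}$ and $m'=\{y\in\mathcal J(\mathcal L_n): y\le m\}$. Then $g\swarrow m$ iff $g\nleq m$ and for all $h\in\mathcal J(\mathcal L_n)$ with $g'\subsetneq h'$ we have $h\le m$; and $g\nearrow m$ iff $g\nleq m$ and for all $y\in\mathcal M(\mathcal L_n)$ with $m'\subsetneq y'$ we have $g\le y$. A partition of $n$ in $\mathcal M(\mathcal L_n)$ is of type IV if it is $(a,t^{[c]},r)$ with $a>t>r\ge0$ and $t,c\ge2$. *)

theory Defs
  imports "HOL-Algebra.Lattice"
begin

section \<open>Irreducible elements and arrow relations\<close>

text \<open>
  Joins and meets are expressed relationally through \<^const>\<open>is_lub\<close> and
  \<^const>\<open>is_glb\<close>, and the extreme elements through \<^const>\<open>least\<close> and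
  \<^const>\<open>greatest\<close>, rather than through the choice-based \<^const>\<open>join\<close>,
  \<^const>\<open>meet\<close>, \<^const>\<open>bottom\<close> and \<^const>\<open>top\<close>.
  In a lattice the two readings agree.
\<close>

definition join_irreducibles :: "('a, 'c) gorder_scheme \<Rightarrow> 'a set" where
  "join_irreducibles L =
     {x \<in> carrier L. \<not> least L x (carrier L) \<and>
        (\<forall>y \<in> carrier L. \<forall>z \<in> carrier L. is_lub L x {y, z} \<longrightarrow> x = y \<or> x = z)}"

definition meet_irreducibles :: "('a, 'c) gorder_scheme \<Rightarrow> 'a set" where
  "meet_irreducibles L =
     {x \<in> carrier L. \<not> greatest L x (carrier L) \<and>
        (\<forall>y \<in> carrier L. \<forall>z \<in> carrier L. is_glb L x {y, z} \<longrightarrow> x = y \<or> x = z)}"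

text \<open>The derivations \<open>g'\<close> and \<open>m'\<close> of the context
  \<open>(join_irreducibles L, meet_irreducibles L, le L)\<close>.\<close>

definition obj_deriv :: "('a, 'c) gorder_scheme \<Rightarrow> 'a \<Rightarrow> 'a set" where
  "obj_deriv L g = {y \<in> meet_irreducibles L. g \<sqsubseteq>\<^bsub>L\<^esub> y}"

definition attr_deriv :: "('a, 'c) gorder_scheme \<Rightarrow> 'a \<Rightarrow> 'a set" where
  "attr_deriv L m = {y \<in> join_irreducibles L. y \<sqsubseteq>\<^bsub>L\<^esub> m}"

text \<open>The arrows are meant for \<open>g \<in> join_irreducibles L\<close> and
  \<open>m \<in> meet_irreducibles L\<close>; these memberships are not part of the definitions.\<close>

definition down_arrow :: "('a, 'c) gorder_scheme \<Rightarrow> 'a \<Rightarrow> 'a \<Rightarrow> bool"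
    (infix \<open>\<swarrow>\<index>\<close> 50) where
  "g \<swarrow>\<^bsub>L\<^esub> m \<longleftrightarrow> \<not> g \<sqsubseteq>\<^bsub>L\<^esub> m \<and>
     (\<forall>h \<in> join_irreducibles L. obj_deriv L g \<subset> obj_deriv L h \<longrightarrow> h \<sqsubseteq>\<^bsub>L\<^esub> m)"

definition up_arrow :: "('a, 'c) gorder_scheme \<Rightarrow> 'a \<Rightarrow> 'a \<Rightarrow> bool"
    (infix \<open>\<nearrow>\<index>\<close> 50) where
  "g \<nearrow>\<^bsub>L\<^esub> m \<longleftrightarrow> \<not> g \<sqsubseteq>\<^bsub>L\<^esub> m \<and>
     (\<forall>y \<in> meet_irreducibles L. attr_deriv L m \<subset> attr_deriv L y \<longrightarrow> g \<sqsubseteq>\<^bsub>L\<^esub> y)"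


section \<open>Partitions under the dominance order\<close>

text \<open>A partition of \<open>n\<close> is a weakly decreasing \<open>n\<close>-tuple, represented by a list
  of length exactly \<open>n\<close>, including the trailing zeros.\<close>

definition partitions :: "nat \<Rightarrow> nat list set" where
  "partitions n = {a. length a = n \<and> sorted_wrt (\<ge>) a \<and> sum_list a = n}"

definition dominated :: "nat \<Rightarrow> nat list \<Rightarrow> nat list \<Rightarrow> bool" where
  "dominated n a b \<longleftrightarrow> (\<forall>j \<in> {1..n}. sum_list (take j a) \<le> sum_list (take j b))"

definition dominance_lattice :: "nat \<Rightarrow> nat list gorder" where
  "dominance_lattice n = \<lparr>carrier = partitions n, eq = (=), le = dominated n\<rparr>"

text \<open>Restores the omitted trailing zeros, turning a list of at most \<open>n\<close> entries into
  an \<open>n\<close>-tuple.\<close>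

definition pad :: "nat \<Rightarrow> nat list \<Rightarrow> nat list" where
  "pad n xs = xs @ replicate (n - length xs) 0"

definition type_IV :: "nat \<Rightarrow> nat list \<Rightarrow> bool" where
  "type_IV n p \<longleftrightarrow> p \<in> meet_irreducibles (dominance_lattice n) \<and>
     (\<exists>a t c r. p = pad n (a # replicate c t @ [r]) \<and>
        a > t \<and> t > r \<and> t \<ge> 2 \<and> c \<ge> 2)"

end

theory Submission
  imports Defs
begin

text \<open>
  Let \<open>s = b + l\<close> and write \<open>X(j)\<close> for the sum of the first \<open>j\<close> parts of \<open>x\<close>. The partition \<open>g\<close>
  is the least one with \<open>X(s) \<ge> n - d\<close>. Hence every partition strictly below \<open>g\<close> lies below the one
  obtained from \<open>g\<close> by moving a box from row \<open>s\<close> to row \<open>s + 1\<close>, so \<open>g\<close> is join-irreducible. Dually,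
  a partition above \<open>m\<close> that agrees with \<open>m\<close> in some \<open>X(j)\<close>, \<open>2 \<le> j \<le> s - 1\<close>, equals \<open>m\<close>, so
  everything strictly above \<open>m\<close> lies above the partition \<open>m\<^sup>*\<close> obtained from \<open>m\<close> by moving a box
  from row \<open>s\<close> to row \<open>2\<close>.

  The sums of \<open>g\<close> exceed those of \<open>m\<close> only at \<open>j = s\<close>, and there only by one. So everything
  strictly below \<open>g\<close> is below \<open>m\<close>, which gives the down arrow. Since \<open>m\<^sup>*\<close> has the same \<open>s\<close>-th sum
  as \<open>m\<close>, it is not above \<open>g\<close>, and a meet-irreducible above \<open>m\<^sup>*\<close> but not above \<open>g\<close> refutes the
  up arrow.
\<close>

section \<open>Irreducible elements of finite partial orders\<close>

lemma join_irreducibles_dual: "join_irreducibles (inv_gorder L) = meet_irreducibles L"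
  unfolding join_irreducibles_def meet_irreducibles_def by simp

lemma meet_irreducibles_dual: "meet_irreducibles (inv_gorder L) = join_irreducibles L"
  unfolding join_irreducibles_def meet_irreducibles_def by simp

text \<open>If \<open>x\<close> were the join of two elements other than \<open>x\<close>, both
  would lie below \<open>w\<close>, hence \<open>x\<close> as well. Likewise \<open>w\<close> keeps
  \<open>x\<close> from being least.\<close>

lemma join_irreducibleI:
  assumes "x \<in> carrier L" "w \<in> carrier L" "\<not> x \<sqsubseteq>\<^bsub>L\<^esub> w"
    and "\<And>y. y \<in> carrier L \<Longrightarrow> y \<sqsubseteq>\<^bsub>L\<^esub> x \<Longrightarrow> y \<noteq> x \<Longrightarrow> y \<sqsubseteq>\<^bsub>L\<^esub> w"
  shows "x \<in> join_irreducibles L"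
  using assms unfolding join_irreducibles_def least_def Upper_def by auto

lemma meet_irreducibleI:
  assumes "x \<in> carrier L" "w \<in> carrier L" "\<not> w \<sqsubseteq>\<^bsub>L\<^esub> x"
    and "\<And>y. y \<in> carrier L \<Longrightarrow> x \<sqsubseteq>\<^bsub>L\<^esub> y \<Longrightarrow> y \<noteq> x \<Longrightarrow> w \<sqsubseteq>\<^bsub>L\<^esub> y"
  shows "x \<in> meet_irreducibles L"
  using join_irreducibleI[of x "inv_gorder L" w] assms by (simp add: join_irreducibles_dual)

text \<open>A maximal element among those above \<open>x\<close> but not above \<open>h\<close>
  works: everything strictly above it is above \<open>h\<close>, so it is not the meet of two such
  elements.\<close>

lemma meet_irreducible_separates:
  assumes "partial_order L" "finite (carrier L)"
    and x: "x \<in> carrier L" and h: "h \<in> carrier L" "\<not> h \<sqsubseteq>\<^bsub>L\<^esub> x"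
  obtains y where "y \<in> meet_irreducibles L" "x \<sqsubseteq>\<^bsub>L\<^esub> y" "\<not> h \<sqsubseteq>\<^bsub>L\<^esub> y"
proof -
  interpret partial_order L by fact
  define A where "A = {y \<in> carrier L. x \<sqsubseteq>\<^bsub>L\<^esub> y \<and> \<not> h \<sqsubseteq>\<^bsub>L\<^esub> y}"
  have A: "finite A" "A \<noteq> {}" "A \<subseteq> carrier L"
    using assms unfolding A_def by auto
  have antisym: "u = v" if "u \<in> A" "v \<in> A" "u \<sqsubseteq>\<^bsub>L\<^esub> v" "v \<sqsubseteq>\<^bsub>L\<^esub> u" for u v
    using le_antisym[OF that(3,4)] that(1,2) A(3) by blast
  have trans: "u \<sqsubseteq>\<^bsub>L\<^esub> w" if "u \<in> A" "v \<in> A" "w \<in> A" "u \<sqsubseteq>\<^bsub>L\<^esub> v" "v \<sqsubseteq>\<^bsub>L\<^esub> w" for u v w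
    using le_trans[OF that(4,5)] that(1-3) A(3) by blast
  have "asymp_on A (\<lambda>y z. y \<sqsubseteq>\<^bsub>L\<^esub> z \<and> y \<noteq> z)"
    using antisym by (intro asymp_onI) blast
  moreover have "transp_on A (\<lambda>y z. y \<sqsubseteq>\<^bsub>L\<^esub> z \<and> y \<noteq> z)"
    using antisym trans by (intro transp_onI) blast
  ultimately obtain y where y: "y \<in> A" and max: "\<forall>z\<in>A. z \<noteq> y \<longrightarrow> \<not> (y \<sqsubseteq>\<^bsub>L\<^esub> z \<and> y \<noteq> z)"
    using Finite_Set.bex_max_element[OF A(1) _ _ A(2)] by blast
  have above: "h \<sqsubseteq>\<^bsub>L\<^esub> z" if "z \<in> carrier L" "y \<sqsubseteq>\<^bsub>L\<^esub> z" "y \<noteq> z" for z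
  proof (rule ccontr)
    assume "\<not> h \<sqsubseteq>\<^bsub>L\<^esub> z"
    moreover have "x \<sqsubseteq>\<^bsub>L\<^esub> z"
      using y that x by (auto simp: A_def intro: le_trans[of x y z])
    ultimately show False
      using max that by (auto simp: A_def)
  qed
  have "y = u \<or> y = v" if "u \<in> carrier L" "v \<in> carrier L" "is_glb L y {u, v}" for u v
  proof (rule ccontr)
    assume "\<not> (y = u \<or> y = v)"
    moreover have "y \<sqsubseteq>\<^bsub>L\<^esub> u" "y \<sqsubseteq>\<^bsub>L\<^esub> v"
      using that unfolding greatest_def Lower_def by auto
    ultimately have "h \<in> Lower L {u, v}"
      using above that(1,2) h(1) unfolding Lower_def by auto
    then have "h \<sqsubseteq>\<^bsub>L\<^esub> y"
      using that(3) unfolding greatest_def by auto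
    then show False
      using y unfolding A_def by simp
  qed
  moreover have "\<not> greatest L y (carrier L)"
    using y h(1) unfolding A_def greatest_def by auto
  ultimately have "y \<in> meet_irreducibles L"
    using y unfolding A_def meet_irreducibles_def by auto
  then show thesis
    using that y unfolding A_def by auto
qed

lemma join_irreducible_separates:
  assumes "partial_order L" "finite (carrier L)"
    and "x \<in> carrier L" "h \<in> carrier L" "\<not> x \<sqsubseteq>\<^bsub>L\<^esub> h"
  obtains y where "y \<in> join_irreducibles L" "y \<sqsubseteq>\<^bsub>L\<^esub> x" "\<not> y \<sqsubseteq>\<^bsub>L\<^esub> h"
  by (rule meet_irreducible_separates[OF partial_order.dual_order[OF assms(1)], of x h])
    (use assms(2-) that in \<open>simp_all add: meet_irreducibles_dual\<close>)

text \<open>Translates the inclusion in the down arrow into the order: a meet-irreducible above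
  \<open>g\<close> but not above \<open>h\<close> would violate it.\<close>

lemma le_if_obj_deriv_subset:
  assumes "partial_order L" "finite (carrier L)" "g \<in> carrier L" "h \<in> carrier L"
    and "obj_deriv L g \<subseteq> obj_deriv L h"
  shows "h \<sqsubseteq>\<^bsub>L\<^esub> g"
proof (rule ccontr)
  assume "\<not> h \<sqsubseteq>\<^bsub>L\<^esub> g"
  then obtain y where "y \<in> meet_irreducibles L" "g \<sqsubseteq>\<^bsub>L\<^esub> y" "\<not> h \<sqsubseteq>\<^bsub>L\<^esub> y"
    using meet_irreducible_separates assms by metis
  then show False
    using assms(5) unfolding obj_deriv_def by auto
qed

text \<open>The witness \<open>w\<close> may be any element: some meet-irreducible above
  \<open>w\<close> is still not above \<open>g\<close>, and a join-irreducible below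
  \<open>w\<close> but not below \<open>m\<close> makes the inclusion of derivations strict.\<close>

lemma not_up_arrowI:
  assumes "partial_order L" "finite (carrier L)"
    and c: "g \<in> carrier L" "m \<in> carrier L" "w \<in> carrier L"
    and mw: "m \<sqsubseteq>\<^bsub>L\<^esub> w" "\<not> w \<sqsubseteq>\<^bsub>L\<^esub> m" and gw: "\<not> g \<sqsubseteq>\<^bsub>L\<^esub> w"
  shows "\<not> g \<nearrow>\<^bsub>L\<^esub> m"
proof -
  interpret partial_order L by fact
  obtain y where y: "y \<in> meet_irreducibles L" "w \<sqsubseteq>\<^bsub>L\<^esub> y" "\<not> g \<sqsubseteq>\<^bsub>L\<^esub> y"
    using meet_irreducible_separates[OF assms(1,2) c(3,1) gw] .
  then have yc: "y \<in> carrier L"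
    unfolding meet_irreducibles_def by simp
  obtain h where h: "h \<in> join_irreducibles L" "h \<sqsubseteq>\<^bsub>L\<^esub> w" "\<not> h \<sqsubseteq>\<^bsub>L\<^esub> m"
    using join_irreducible_separates[OF assms(1,2) c(3,2) mw(2)] .
  have jc: "x \<in> carrier L" if "x \<in> join_irreducibles L" for x
    using that unfolding join_irreducibles_def by simp
  have "attr_deriv L m \<subseteq> attr_deriv L y"
    using le_trans[OF _ le_trans[OF mw(1) y(2)]] c yc jc unfolding attr_deriv_def by auto
  moreover have "h \<in> attr_deriv L y - attr_deriv L m"
    using le_trans[OF h(2) y(2)] h c(3) yc jc unfolding attr_deriv_def by simp
  ultimately show ?thesis
    using y unfolding up_arrow_def by blast
qed


section \<open>Partitions as decreasing functions\<close>

lemma sum_list_take_map_upt: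
  "j \<le> n \<Longrightarrow> sum_list (take j (map f [0..<n])) = (\<Sum>i<j. f i)" for f :: "nat \<Rightarrow> nat"
  by (simp add: take_map interv_sum_list_conv_sum_set_nat atLeast0LessThan)

lemma dominated_map_upt:
  "dominated n (map f [0..<n]) (map h [0..<n]) \<longleftrightarrow> (\<forall>j\<le>n. (\<Sum>i<j. f i) \<le> (\<Sum>i<j. h i))"
proof -
  have "dominated n (map f [0..<n]) (map h [0..<n])
      \<longleftrightarrow> (\<forall>j\<in>{1..n}. (\<Sum>i<j. f i) \<le> (\<Sum>i<j. h i))"
    unfolding dominated_def by (intro ball_cong refl) (simp add: sum_list_take_map_upt)
  also have "\<dots> \<longleftrightarrow> (\<forall>j\<le>n. (\<Sum>i<j. f i) \<le> (\<Sum>i<j. h i))"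
    by (metis atLeastAtMost_iff lessThan_0 less_one not_le order_refl sum.empty)
  finally show ?thesis .
qed

lemma not_dominated_map_uptI:
  assumes "j \<le> n" "(\<Sum>i<j. h i) < (\<Sum>i<j. f i)"
  shows "\<not> dominated n (map f [0..<n]) (map h [0..<n])"
  unfolding dominated_map_upt using assms by (auto simp: not_le)

lemma map_upt_in_partitions:
  assumes "antimono f" "(\<Sum>i<n. f i) = n"
  shows "map f [0..<n] \<in> partitions n"
proof -
  have "sum_list (map f [0..<n]) = n"
    using assms(2) sum_list_take_map_upt[of n n f] by simp
  moreover have "sorted_wrt (\<ge>) (map f [0..<n])"
    unfolding sorted_wrt_iff_nth_less using antimonoD[OF assms(1)] by simp
  ultimately show ?thesis
    unfolding partitions_def by simp
qed

lemma partitionsE: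
  assumes "x \<in> partitions n"
  obtains f where "antimono f" "(\<Sum>i<n. f i) = n" "x = map f [0..<n]"
proof -
  \<comment> \<open>The value 0 beyond the tuple keeps \<open>f\<close> decreasing on all natural
    numbers.\<close>
  define f where "f i = (if i < n then x ! i else 0)" for i
  have x: "length x = n" "sorted_wrt (\<ge>) x" "sum_list x = n"
    using assms unfolding partitions_def by auto
  have "antimono f"
    using x(1,2) unfolding f_def
    by (intro antimonoI) (auto simp: sorted_wrt_iff_nth_less le_less)
  moreover have eq: "x = map f [0..<n]"
    using x(1) unfolding f_def by (intro nth_equalityI) auto
  moreover have "(\<Sum>i<n. f i) = n"
    using sum_list_take_map_upt[of n n f] x(1,3) eq by simp
  ultimately show thesis
    using that by blast
qed

lemma partial_order_dominance: "partial_order (dominance_lattice n)"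
proof (unfold_locales; (simp add: dominance_lattice_def)?)
  fix x y assume xy: "dominated n x y" "dominated n y x" "x \<in> partitions n" "y \<in> partitions n"
  have len: "length x = n" "length y = n"
    using xy(3,4) by (auto simp: partitions_def)
  have sums: "sum_list (take j x) = sum_list (take j y)" if "j \<le> n" for j
    using xy(1,2) that unfolding dominated_def
    by (cases "j = 0") (auto intro!: antisym)
  show "x = y"
  proof (rule nth_equalityI)
    fix i assume "i < length x"
    then show "x ! i = y ! i"
      using sums[of i] sums[of "Suc i"] len by (simp add: take_Suc_conv_app_nth)
  qed (simp add: len)
next
  fix x y z assume "dominated n x y" "dominated n y z"
  then show "dominated n x z"
    unfolding dominated_def by (meson order_trans)
qed (simp add: dominated_def)

lemma finite_partitions: "finite (partitions n)"
proof (rule finite_subset)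
  show "partitions n \<subseteq> {xs. set xs \<subseteq> {..n} \<and> length xs \<le> n}"
    unfolding partitions_def using member_le_sum_list by fastforce
qed (simp add: finite_lists_length_le)

text \<open>Rows count from 0 here, from 1 in the overview. Only the prefixes containing row
  \<open>i\<close> but not row \<open>j\<close> gain the box; \<open>0 < f j\<close> guards the
  truncated subtraction.\<close>

lemma sum_move_box:
  fixes f :: "nat \<Rightarrow> nat"
  assumes "i < j" "0 < f j"
  shows "(\<Sum>q<p. (f(i := f i + 1, j := f j - 1)) q)
    = (\<Sum>q<p. f q) + (if i < p \<and> p \<le> j then 1 else 0)"
  using assms
proof (induction p)
  case (Suc p)
  consider "p < i" | "p = i" | "i < p" "p < j" | "p = j" | "j < p"
    using assms(1) by linarith
  then show ?case
    by cases (use Suc in auto)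
qed simp


section \<open>The two partitions\<close>

text \<open>\<open>s\<close> is the index at which the rows of length \<open>k\<close> end, not
  their number; it is used with \<open>s = b + l\<close>.\<close>

definition flat_rows :: "nat \<Rightarrow> nat \<Rightarrow> nat \<Rightarrow> nat \<Rightarrow> nat \<Rightarrow> nat" where
  "flat_rows k b s d i = (if i < b then k + 1 else if i < s then k else if i < s + d then 1 else 0)"

lemma sum_flat_rows:
  assumes "b \<le> s"
  shows "(\<Sum>i<j. flat_rows k b s d i) = (if j \<le> s then j * k + min j b else s * k + b + min (j - s) d)"
proof (induction j)
  case (Suc j)
  consider "j < b" | "b \<le> j" "j < s" | "j = s" | "s < j"
    by linarith
  then show ?case
    using assms Suc by cases (auto simp: flat_rows_def)
qed simp

text \<open>For \<open>j \<le> s\<close>, either rows \<open>j\<close> to \<open>s - 1\<close> have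
  length at most \<open>k\<close> and leave enough for the first \<open>j\<close>, or the first
  \<open>j\<close> rows all exceed \<open>k\<close>. For \<open>j > s\<close>, either a zero row
  shows that all of \<open>n\<close> is used up, or each row from \<open>s\<close> on adds at least
  1.\<close>

lemma flat_rows_least:
  assumes "antimono f" "(\<Sum>i<n. f i) = n" "n = s * k + b + d" "b \<le> s"
    and s: "s * k + b \<le> (\<Sum>i<s. f i)" and "j \<le> n"
  shows "(\<Sum>i<j. flat_rows k b s d i) \<le> (\<Sum>i<j. f i)"
proof (cases "j \<le> s")
  case True
  show ?thesis
  proof (cases "f j \<le> k")
    case True
    have "(\<Sum>i<s. f i) = (\<Sum>i<j. f i) + (\<Sum>i=j..<s. f i)"
      using \<open>j \<le> s\<close> by (simp add: sum.atLeastLessThan_concat lessThan_atLeast0)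
    moreover have "(\<Sum>i=j..<s. f i) \<le> of_nat (card {j..<s}) * k"
      using True antimonoD[OF assms(1), of j] by (intro sum_bounded_above) fastforce
    moreover have "s * k = j * k + (s - j) * k"
      using \<open>j \<le> s\<close> by (metis add_mult_distrib le_add_diff_inverse)
    ultimately show ?thesis
      using \<open>j \<le> s\<close> s by (simp add: sum_flat_rows assms(4))
  next
    case False
    have "of_nat (card {..<j}) * (k + 1) \<le> (\<Sum>i<j. f i)"
    proof (rule sum_bounded_below)
      fix i assume "i \<in> {..<j}"
      then show "k + 1 \<le> f i"
        using False antimonoD[OF assms(1), of i j] by auto
    qed
    then show ?thesis
      using True by (simp add: sum_flat_rows assms(4))
  qed
next
  case False
  show ?thesis
  proof (cases "\<exists>i<j. f i = 0")
    case True
    then obtain i where i: "i < j" "f i = 0" by auto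
    then have "\<forall>q\<ge>i. f q = 0"
      using antimonoD[OF assms(1)] by (metis le_zero_eq)
    then have "(\<Sum>i<n. f i) = (\<Sum>i<j. f i)"
      using i \<open>j \<le> n\<close> by (intro sum.mono_neutral_right) auto
    then show ?thesis
      using False assms(2,3) by (simp add: sum_flat_rows assms(4))
  next
    case nz: False
    have "(\<Sum>i<j. f i) = (\<Sum>i<s. f i) + (\<Sum>i=s..<j. f i)"
      using False by (simp add: sum.atLeastLessThan_concat lessThan_atLeast0)
    moreover have "of_nat (card {s..<j}) * 1 \<le> (\<Sum>i=s..<j. f i)"
      using nz by (intro sum_bounded_below) (simp add: Suc_leI)
    ultimately show ?thesis
      using False s by (simp add: sum_flat_rows assms(4))
  qed
qed

definition hook_rows :: "nat \<Rightarrow> nat \<Rightarrow> nat \<Rightarrow> nat \<Rightarrow> nat \<Rightarrow> nat" where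
  "hook_rows a t s r i = (if i = 0 then a else if i < s then t else if i = s then r else 0)"

lemma sum_hook_rows:
  assumes "1 \<le> s"
  shows "(\<Sum>i<j. hook_rows a t s r i)
    = (if j = 0 then 0 else if j \<le> s then a + (j - 1) * t else a + (s - 1) * t + r)"
proof (induction j)
  case (Suc j)
  consider "j = 0" | i where "j = Suc i" "j < s" | i where "j = s" "s = Suc i" | "s < j"
    using assms by (metis not0_implies_Suc not_less_iff_gr_or_eq not_one_le_zero)
  then show ?case
    using assms Suc by cases (auto simp: hook_rows_def)
qed simp

text \<open>At an inner index where \<open>f\<close> touches the hook, the part before is at most \<open>t\<close> and the part
  after is at least \<open>t\<close>, so by monotonicity \<open>f\<close> lies below the hook on both sides.\<close>

lemma hook_rows_touching:
  assumes "antimono f" "(\<Sum>i<n. f i) = n" "n = a + (s - 1) * t + r"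
    and above: "\<And>j. j \<le> n \<Longrightarrow> (\<Sum>i<j. hook_rows a t s r i) \<le> (\<Sum>i<j. f i)"
    and p: "2 \<le> p" "p < s" "s \<le> n" and touch: "(\<Sum>i<p. f i) \<le> (\<Sum>i<p. hook_rows a t s r i)"
    and "j \<le> n"
  shows "(\<Sum>i<j. f i) \<le> (\<Sum>i<j. hook_rows a t s r i)"
proof -
  have s: "1 \<le> s" using p by simp
  note sums = sum_hook_rows[OF s]
  \<comment> \<open>As \<open>2 \<le> p < s\<close>, rows \<open>p - 1\<close> and \<open>p\<close>
    of the hook both have length \<open>t\<close>; comparing consecutive sums bounds
    \<open>f\<close> there.\<close>
  obtain q where q: "p = Suc (Suc q)"
    using p(1) by (metis add_2_eq_Suc le_Suc_ex)
  have hook: "(\<Sum>i<Suc q. hook_rows a t s r i) = a + q * t"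
    "(\<Sum>i<p. hook_rows a t s r i) = a + q * t + t"
    "(\<Sum>i<Suc p. hook_rows a t s r i) = a + q * t + t + t"
    unfolding sums using p by (auto simp: q)
  have fp: "f (Suc q) \<le> t"
    using above[of "Suc q"] touch p unfolding hook by (simp add: q)
  have fp': "t \<le> f p"
    using above[of "Suc p"] touch p unfolding hook by simp
  consider "j = 0" | "0 < j" "j \<le> p" | "p < j" "j \<le> s" | "s < j" by linarith
  then show ?thesis
  proof cases
    case 2
    have "(\<Sum>i<p. f i) = (\<Sum>i<j. f i) + (\<Sum>i=j..<p. f i)"
      using 2 by (simp add: sum.atLeastLessThan_concat lessThan_atLeast0)
    moreover have "of_nat (card {j..<p}) * t \<le> (\<Sum>i=j..<p. f i)"
      using fp' antimonoD[OF assms(1)] by (intro sum_bounded_below) (meson atLeastLessThan_iff less_imp_le order_trans)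
    moreover have "(p - 1) * t = (j - 1) * t + (p - j) * t"
      using 2 by (simp add: add_mult_distrib[symmetric])
    ultimately show ?thesis
      using 2 p touch by (simp add: sums)
  next
    case 3
    have "(\<Sum>i<j. f i) = (\<Sum>i<p. f i) + (\<Sum>i=p..<j. f i)"
      using 3 by (simp add: sum.atLeastLessThan_concat lessThan_atLeast0)
    moreover have "(\<Sum>i=p..<j. f i) \<le> of_nat (card {p..<j}) * t"
    proof (rule sum_bounded_above)
      fix i assume "i \<in> {p..<j}"
      then show "f i \<le> t"
        using fp antimonoD[OF assms(1), of "Suc q" i] q by auto
    qed
    moreover have "(j - 1) * t = (p - 1) * t + (j - p) * t"
      using 3 p by (simp add: add_mult_distrib[symmetric])
    ultimately show ?thesis
      using 3 p touch by (simp add: sums)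
  next
    case 4
    have "(\<Sum>i<j. f i) \<le> (\<Sum>i<n. f i)"
      using \<open>j \<le> n\<close> by (intro sum_mono2) auto
    then show ?thesis
      using 4 assms(2,3) p by (simp add: sums)
  qed simp
qed

section \<open>The arrows between \<open>g\<close> and \<open>m\<close>\<close>

theorem corollary5p7:
  fixes b d k l n t a :: nat and g m :: "nat list"
  assumes "k \<ge> 1" and "l \<ge> 1"
    and "b + l \<ge> 3"
    and "k \<ge> d + 3"
    and "n = b * (k + 1) + l * k + d"
    and "d + 1 < t" and "t \<le> k - 1"
    and "a = b + (b + l) * (k - t) + t - 1"
    and "g = pad n (replicate b (k + 1) @ replicate l k @ replicate d 1)"
    and "m = pad n (a # replicate (b + l - 1) t @ [d + 1])"
  shows "g \<in> join_irreducibles (dominance_lattice n) \<and>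
         m \<in> meet_irreducibles (dominance_lattice n) \<and>
         type_IV n m \<and>
         a \<ge> t + 2 \<and>
         g \<swarrow>\<^bsub>dominance_lattice n\<^esub> m \<and>
         \<not> g \<nearrow>\<^bsub>dominance_lattice n\<^esub> m"
proof -
  let ?L = "dominance_lattice n"
  define s where "s = b + l"
  have s: "3 \<le> s" "b < s" using assms(2,3) by (auto simp: s_def)
  have n: "n = s * k + b + d" using assms(5) by (simp add: s_def algebra_simps)
  have "s * 3 \<le> s * k" using assms(4) by (intro mult_le_mono2) simp
  then have sn: "s + d + 1 \<le> n" using s n by linarith
  \<comment> \<open>Adding 1 removes the truncated subtraction from the definition of
    \<open>a\<close>.\<close>
  have a': "a + 1 = b + s * (k - t) + t"
    using assms(6) unfolding assms(8) s_def by simp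
  have "s * 1 \<le> s * (k - t)" using assms(4,7) by (intro mult_le_mono2) simp
  then have a: "t + 2 \<le> a" using a' s by linarith
  have kt: "s * k = s * (k - t) + s * t"
    using assms(4,7) by (simp add: add_mult_distrib2[symmetric])
  have st: "s * t = t + (s - 1) * t"
    using s by (cases s) auto
  have n': "n = a + (s - 1) * t + (d + 1)"
    using n a' kt st by linarith

  define gf where "gf = flat_rows k b s d"
  \<comment> \<open>\<open>gl\<close> is the partition just below \<open>g\<close>, and
    \<open>mu\<close> is the \<open>m\<^sup>*\<close> of the overview.\<close>
  define gl where "gl = gf(s - 1 := k - 1, s := gf s + 1)"
  define mf where "mf = hook_rows a t s (d + 1)"
  define mu where "mu = mf(1 := mf 1 + 1, s - 1 := mf (s - 1) - 1)"
  have sg: "(\<Sum>i<j. gf i) = (if j \<le> s then j * k + min j b else s * k + b + min (j - s) d)" for j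
    unfolding gf_def using s by (intro sum_flat_rows) simp
  have sm: "(\<Sum>i<j. mf i) = (if j = 0 then 0 else if j \<le> s then a + (j - 1) * t else n)" for j
    unfolding mf_def using s n' by (subst sum_hook_rows) auto
  have smu: "(\<Sum>i<j. mu i) = (\<Sum>i<j. mf i) + (if 1 < j \<and> j \<le> s - 1 then 1 else 0)" for j
    unfolding mu_def using s assms(6) by (intro sum_move_box) (auto simp: mf_def hook_rows_def)
  \<comment> \<open>Moving the box back up recovers \<open>gf\<close>, so
    \<open>sum_move_box\<close> applies in reverse.\<close>
  have "gf = gl(s - 1 := gl (s - 1) + 1, s := gl s - 1)"
    using s assms(4) by (auto simp: gl_def gf_def flat_rows_def fun_eq_iff)
  moreover have "(\<Sum>i<j. (gl(s - 1 := gl (s - 1) + 1, s := gl s - 1)) i)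
      = (\<Sum>i<j. gl i) + (if s - 1 < j \<and> j \<le> s then 1 else 0)" for j
    using s by (intro sum_move_box) (auto simp: gl_def)
  ultimately have sgl: "(\<Sum>i<j. gf i) = (\<Sum>i<j. gl i) + (if j = s then 1 else 0)" for j
    using s by (auto split: if_splits)

  have g: "g = map gf [0..<n]"
    unfolding assms(9) pad_def using sn s
    by (intro nth_equalityI) (auto simp: gf_def flat_rows_def nth_append s_def)
  have m: "m = map mf [0..<n]"
    unfolding assms(10) pad_def using sn s
    by (intro nth_equalityI)
      (auto simp: mf_def hook_rows_def nth_append nth_Cons' s_def)
  have "antimono gf"
    unfolding gf_def antimono_iff_le_Suc using assms(1) by (auto simp: flat_rows_def)
  moreover have "(\<Sum>i<n. gf i) = n"
    using sn n by (simp add: sg)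
  ultimately have gc: "g \<in> partitions n"
    unfolding g by (intro map_upt_in_partitions)
  have "antimono mf"
    unfolding mf_def antimono_iff_le_Suc using a assms(6) by (auto simp: hook_rows_def)
  moreover have "(\<Sum>i<n. mf i) = n"
    using sn by (simp add: sm)
  ultimately have mc: "m \<in> partitions n"
    unfolding m by (intro map_upt_in_partitions)
  have "antimono gl"
    unfolding antimono_iff_le_Suc
  proof
    fix i
    have step: "gf (Suc i) \<le> gf i"
      using \<open>antimono gf\<close> by (simp add: antimono_iff_le_Suc)
    have vals: "gf (s - 1) = k" "gf s \<le> 1"
      using s by (auto simp: gf_def flat_rows_def)
    consider "Suc i = s - 1" | "Suc i = s" | "i = s" | "Suc i \<noteq> s - 1" "Suc i \<noteq> s" "i \<noteq> s"
      by blast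
    then show "gl (Suc i) \<le> gl i"
      by cases (use step vals s assms(4) in \<open>auto simp: gl_def\<close>)
  qed
  moreover have "(\<Sum>i<n. gl i) = n"
    using sgl[of n] \<open>(\<Sum>i<n. gf i) = n\<close> sn by simp
  ultimately have glc: "map gl [0..<n] \<in> partitions n"
    by (intro map_upt_in_partitions)
  \<comment> \<open>Row 1 grows to \<open>t + 1 < a\<close>, and row \<open>s - 1\<close> shrinks to
    \<open>t - 1 \<ge> d + 1\<close>.\<close>
  have "antimono mu"
    unfolding antimono_iff_le_Suc
  proof
    fix i
    have step: "mf (Suc i) \<le> mf i"
      using \<open>antimono mf\<close> by (simp add: antimono_iff_le_Suc)
    have vals: "mf 0 = a" "mf 1 = t" "mf (s - 1) = t" "mf s = d + 1"
      using s by (auto simp: mf_def hook_rows_def)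
    consider "i = 0" | "Suc i = s - 1" | "Suc i = s" | "i \<noteq> 0" "Suc i \<noteq> s - 1" "Suc i \<noteq> s"
      by blast
    then show "mu (Suc i) \<le> mu i"
      by cases (use step vals s a assms(6) in \<open>auto simp: mu_def\<close>)
  qed
  moreover have "(\<Sum>i<n. mu i) = n"
    using smu[of n] \<open>(\<Sum>i<n. mf i) = n\<close> sn s by auto
  ultimately have muc: "map mu [0..<n] \<in> partitions n"
    by (intro map_upt_in_partitions)

  interpret partial_order ?L by (rule partial_order_dominance)
  have fin: "finite (carrier ?L)"
    by (simp add: dominance_lattice_def finite_partitions)
  have L: "carrier ?L = partitions n" "le ?L = dominated n"
    by (auto simp: dominance_lattice_def)

  \<comment> \<open>The value of \<open>a\<close> is chosen to make this gap exactly 1.\<close>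
  have at_s: "(\<Sum>i<s. gf i) = (\<Sum>i<s. mf i) + 1"
    using s a' kt st by (simp add: sg sm)
  have off_s: "(\<Sum>i<j. gf i) \<le> (\<Sum>i<j. mf i)" if "j \<noteq> s" for j
  proof -
    consider "j = 0" | "0 < j" "j < s" | "s < j" using \<open>j \<noteq> s\<close> by linarith
    then show ?thesis
    proof cases
      case 2
      \<comment> \<open>Since \<open>t < k\<close> and \<open>j < s\<close>, this term compensates
        for the \<open>- 1\<close> in \<open>a\<close>.\<close>
      have "(s - j) * 1 \<le> (s - j) * (k - t)"
        using assms(4,7) by (intro mult_le_mono2) simp
      moreover have "s * (k - t) = j * (k - t) + (s - j) * (k - t)"
        using 2 by (simp add: add_mult_distrib[symmetric])
      moreover have "j * k = j * (k - t) + j * t"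
        using assms(7) by (simp add: add_mult_distrib2[symmetric])
      moreover have "j * t = t + (j - 1) * t"
        using 2 by (cases j) auto
      ultimately have "j * k + min j b \<le> a + (j - 1) * t"
        using 2 a' min.cobounded2[of j b] by linarith
      then show ?thesis
        using 2 by (simp add: sg sm)
    qed (use s n sm sg in auto)
  qed

  have below_g: "(\<Sum>i<s. f i) < (\<Sum>i<s. gf i)"
    if "antimono f" "(\<Sum>i<n. f i) = n" "dominated n (map f [0..<n]) g" "map f [0..<n] \<noteq> g" for f
  proof (rule ccontr)
    assume "\<not> ?thesis"
    \<comment> \<open>Reaching the sum of \<open>g\<close> at \<open>s\<close> already forces
      domination of \<open>g\<close>, by its minimality.\<close>
    then have "dominated n g (map f [0..<n])"
      unfolding g dominated_map_upt gf_def
      using flat_rows_least[OF that(1,2) n] s by (auto simp: sg gf_def[symmetric])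
    then show False
      using le_antisym[of "map f [0..<n]" g] that gc map_upt_in_partitions[OF that(1,2)]
      unfolding L by blast
  qed
  have above_m: "dominated n (map mu [0..<n]) (map f [0..<n])"
    if "antimono f" "(\<Sum>i<n. f i) = n" "dominated n m (map f [0..<n])" "map f [0..<n] \<noteq> m" for f
  proof (rule ccontr)
    assume "\<not> ?thesis"
    then obtain p where p: "p \<le> n" "(\<Sum>i<p. f i) < (\<Sum>i<p. mu i)"
      unfolding dominated_map_upt by (auto simp: not_le)
    have le: "(\<Sum>i<j. mf i) \<le> (\<Sum>i<j. f i)" if "j \<le> n" for j
      using \<open>dominated n m (map f [0..<n])\<close> that unfolding m dominated_map_upt by simp
    \<comment> \<open>\<open>mu\<close> exceeds \<open>mf\<close> only at these indices and only by
      1, so \<open>f\<close> touches \<open>m\<close> at \<open>p\<close>.\<close>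
    have p': "2 \<le> p" "p < s" "(\<Sum>i<p. f i) \<le> (\<Sum>i<p. mf i)"
      using p le[OF p(1)] smu[of p] s by (auto split: if_splits)
    have "dominated n (map f [0..<n]) m"
      unfolding m dominated_map_upt mf_def
      using hook_rows_touching[OF that(1,2) n' le[unfolded mf_def] p'(1,2) _ p'(3)[unfolded mf_def]] sn
      by simp
    then show False
      using le_antisym[of "map f [0..<n]" m] that mc map_upt_in_partitions[OF that(1,2)]
      unfolding L by blast
  qed

  have gJ: "g \<in> join_irreducibles ?L"
  proof (rule join_irreducibleI)
    show "\<not> g \<sqsubseteq>\<^bsub>?L\<^esub> map gl [0..<n]"
      unfolding L g using sgl[of s] sn by (intro not_dominated_map_uptI[of s]) simp_all
  next
    fix y assume "y \<in> carrier ?L" and y: "y \<sqsubseteq>\<^bsub>?L\<^esub> g" "y \<noteq> g"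
    then obtain f where f: "antimono f" "(\<Sum>i<n. f i) = n" "y = map f [0..<n]"
      unfolding L by (elim partitionsE)
    \<comment> \<open>The sums of \<open>gl\<close> and \<open>g\<close> differ only at
      \<open>s\<close>, where this strict inequality supplies the missing 1.\<close>
    have "(\<Sum>i<s. f i) < (\<Sum>i<s. gf i)"
      using below_g f y by (simp add: L)
    then show "y \<sqsubseteq>\<^bsub>?L\<^esub> map gl [0..<n]"
      using y(1) sgl unfolding L f(3) g dominated_map_upt by (auto split: if_splits)
  qed (simp_all add: L gc glc)

  \<comment> \<open>Index 2 is the first where \<open>mu\<close> gains; it is in range because
    \<open>s \<ge> 3\<close>.\<close>
  have mu_m: "\<not> map mu [0..<n] \<sqsubseteq>\<^bsub>?L\<^esub> m"
    unfolding L m using smu[of 2] s sn by (intro not_dominated_map_uptI[of 2]) simp_all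
  have mM: "m \<in> meet_irreducibles ?L"
  proof (rule meet_irreducibleI)
    fix y assume "y \<in> carrier ?L" and y: "m \<sqsubseteq>\<^bsub>?L\<^esub> y" "y \<noteq> m"
    then obtain f where f: "antimono f" "(\<Sum>i<n. f i) = n" "y = map f [0..<n]"
      unfolding L by (elim partitionsE)
    then show "map mu [0..<n] \<sqsubseteq>\<^bsub>?L\<^esub> y"
      using above_m y by (simp add: L)
  qed (use mc muc mu_m in \<open>simp_all add: L\<close>)

  have IV: "type_IV n m"
    unfolding type_IV_def
    by (intro conjI mM exI[of _ a] exI[of _ t] exI[of _ "s - 1"] exI[of _ "d + 1"])
      (use a s assms(6,10) in \<open>auto simp: s_def\<close>)

  have "g \<swarrow>\<^bsub>?L\<^esub> m"
    unfolding down_arrow_def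
  proof (intro conjI ballI impI)
    show "\<not> g \<sqsubseteq>\<^bsub>?L\<^esub> m"
      unfolding L g m using at_s sn by (intro not_dominated_map_uptI[of s]) simp_all
  next
    fix h assume "h \<in> join_irreducibles ?L" and sub: "obj_deriv ?L g \<subset> obj_deriv ?L h"
    then have hc: "h \<in> partitions n"
      unfolding join_irreducibles_def L by simp
    have hg: "dominated n h g" "h \<noteq> g"
      using le_if_obj_deriv_subset[OF partial_order_dominance fin, of g h] gc hc sub
      by (auto simp: L)
    obtain f where f: "antimono f" "(\<Sum>i<n. f i) = n" "h = map f [0..<n]"
      using hc by (elim partitionsE)
    \<comment> \<open>Off \<open>s\<close> the bound passes through \<open>g\<close>; at
      \<open>s\<close> strictness below \<open>g\<close> absorbs the excess of 1.\<close>
    have "(\<Sum>i<j. f i) \<le> (\<Sum>i<j. mf i)" if "j \<le> n" for j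
    proof (cases "j = s")
      case True
      then show ?thesis
        using below_g[OF f(1,2)] hg at_s f(3) by simp
    next
      case False
      then show ?thesis
        using off_s[of j] that hg(1) unfolding f(3) g dominated_map_upt by (meson order_trans)
    qed
    then show "h \<sqsubseteq>\<^bsub>?L\<^esub> m"
      unfolding L f(3) m dominated_map_upt by simp
  qed
  moreover have "\<not> g \<nearrow>\<^bsub>?L\<^esub> m"
  proof (rule not_up_arrowI[OF partial_order_dominance fin])
    show "m \<sqsubseteq>\<^bsub>?L\<^esub> map mu [0..<n]"
      unfolding L m dominated_map_upt by (simp add: smu)
    show "\<not> g \<sqsubseteq>\<^bsub>?L\<^esub> map mu [0..<n]"
      unfolding L g using at_s smu[of s] s sn by (intro not_dominated_map_uptI[of s]) auto
  qed (use gc mc muc mu_m in \<open>simp_all add: L\<close>)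
  ultimately show ?thesis
    using gJ mM IV a by blast
qed

end
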